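(* Let $f=a_0+a_1x+\cdots+a_nx^n\in\mathbb{Z}[x]$ be a primitive polynomial such that each zero $\theta\in\mathbb{C}$ of $f$ satisfies $|\theta|>d$, where $a_0=\pm p^k d$ for some positive integers $k$ and $d$, and a prime $p\nmid d$. Suppose $j\in\{1,\ldots,n\}$ is such that $\gcd(k,j)=1$, $p^k\mid\gcd(a_0,a_1,\ldots,a_{j-1})$, and, in the case $k>1$, $p\nmid a_j$. Then $f$ is irreducible in $\mathbb{Z}[x]$.
   Context: A polynomial with integer coefficients is called primitive if the greatest common divisor of all its coefficients is $1$. *)

theory Defs
  imports Complex_Main "HOL-Computational_Algebra.Computational_Algebra"
begin

end

theory Submission imports Defs
begin

text \<open>
  Each factor of \<open>f\<close> has only roots of modulus greater than \<open>d\<close>. Up to sign the constant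
  coefficient of a polynomial is its leading coefficient times the product of its roots, so every
  nonconstant integer factor \<open>g\<close> of \<open>f\<close> has \<open>\<bar>g(0)\<bar> > d\<close>
  (\<open>nonconstant_int_poly_large_constant_coeff\<close>). As \<open>f\<close> is primitive, a
  nontrivial factorization \<open>f = g h\<close> has both factors nonconstant, and \<open>p\<close> must then divide both
  \<open>g(0)\<close> and \<open>h(0)\<close>: if, say, \<open>p\<close> does not divide \<open>g(0)\<close>, then \<open>g(0)\<close> divides
  \<open>p ^ k * d\<close> and is coprime to \<open>p\<close>, so it divides \<open>d\<close>, which is too small. For \<open>k = 1\<close> this is absurd, because \<open>f(0)\<close> is divisible by \<open>p\<close> only once.

  For \<open>k > 1\<close> the contradiction is Dumas' argument on Newton polygons. With respect to \<open>p\<close>, the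
  polygon of \<open>f\<close> starts with the edge from \<open>(0, k)\<close> to \<open>(j, 0)\<close>, which has no interior lattice
  points as \<open>k\<close> and \<open>j\<close> are coprime. The edges of slope \<open>-k/j\<close> of \<open>g\<close> and \<open>h\<close> make up this edge,
  so it belongs to one of the factors and the other one has a constant coefficient prime to \<open>p\<close>
  (\<open>coprime_edge_imp_not_both_dvd\<close>). Only one slope matters, so instead of the whole polygon it
  suffices to consider the weight \<open>j * v(a\<^sub>i) + k * i\<close>, where \<open>v\<close> is the
  multiplicity of \<open>p\<close>; it is constant along that edge. It remains to show that its
  minimum is additive under multiplication (\<open>least_weight_mult\<close>), as in the proof of Gauss' lemma.
\<close>

section \<open>Weights of coefficients along a fixed slope\<close>

definition slope_weight :: "'a::factorial_semiring \<Rightarrow> nat \<Rightarrow> nat \<Rightarrow> 'a poly \<Rightarrow> nat \<Rightarrow> nat" where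
  "slope_weight p j k g i = j * multiplicity p (coeff g i) + k * i"

lemma first_minimizer:
  fixes w :: "nat \<Rightarrow> nat"
  assumes "A \<noteq> {}"
  obtains s where "s \<in> A" "\<And>i. i \<in> A \<Longrightarrow> w s \<le> w i" "\<And>i. i \<in> A \<Longrightarrow> i < s \<Longrightarrow> w s < w i"
proof -
  obtain a where a: "a \<in> A" "\<And>i. i \<in> A \<Longrightarrow> w a \<le> w i"
    using assms ex_has_least_nat[of "\<lambda>i. i \<in> A" _ w] by auto
  define s where "s = (LEAST i. i \<in> A \<and> w i = w a)"
  have s: "s \<in> A" "w s = w a"
    using LeastI[of "\<lambda>i. i \<in> A \<and> w i = w a" a] a(1) unfolding s_def by auto
  have "w s < w i" if "i \<in> A" "i < s" for i
    using not_less_Least[of i "\<lambda>i. i \<in> A \<and> w i = w a"] that a(2)[of i] s(2)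
    unfolding s_def by fastforce
  with s a(2) show thesis by (intro that[of s]) auto
qed

text \<open>
  The minimal weight of a product is at least the sum of the minimal weights of the factors, for
  each term \<open>coeff g i * coeff h l\<close> is at least that heavy. It is attained because the first indices
  \<open>s\<close> and \<open>t\<close> of minimal weight give the only term of \<open>coeff (g * h) (s + t)\<close> of that weight:
  any other term has \<open>i < s\<close> or \<open>l < t\<close>, hence is heavier, hence more divisible by \<open>p\<close>.
\<close>
lemma least_weight_mult:
  fixes g h :: "'a::{factorial_semiring,idom} poly"
  assumes p: "prime_elem p" and j: "j > 0" and "g \<noteq> 0" "h \<noteq> 0"
  obtains s t where
    "\<And>i. coeff g i \<noteq> 0 \<Longrightarrow> slope_weight p j k g s \<le> slope_weight p j k g i"
    "\<And>i. coeff h i \<noteq> 0 \<Longrightarrow> slope_weight p j k h t \<le> slope_weight p j k h i"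
    "coeff (g * h) (s + t) \<noteq> 0"
    "slope_weight p j k (g * h) (s + t) = slope_weight p j k g s + slope_weight p j k h t"
proof -
  let ?w = "slope_weight p j k" and ?v = "multiplicity p"
  have ne: "{i. coeff g i \<noteq> 0} \<noteq> {}" "{i. coeff h i \<noteq> 0} \<noteq> {}"
    using assms(3,4) by (auto simp: poly_eq_iff)
  obtain s where
    s: "coeff g s \<noteq> 0" "\<And>i. coeff g i \<noteq> 0 \<Longrightarrow> ?w g s \<le> ?w g i"
       "\<And>i. coeff g i \<noteq> 0 \<Longrightarrow> i < s \<Longrightarrow> ?w g s < ?w g i"
    by (rule first_minimizer[OF ne(1), of "?w g"]) auto
  obtain t where
    t: "coeff h t \<noteq> 0" "\<And>i. coeff h i \<noteq> 0 \<Longrightarrow> ?w h t \<le> ?w h i"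
       "\<And>i. coeff h i \<noteq> 0 \<Longrightarrow> i < t \<Longrightarrow> ?w h t < ?w h i"
    by (rule first_minimizer[OF ne(2), of "?w h"]) auto
  define e where "e = ?v (coeff g s) + ?v (coeff h t)"
  let ?rest = "\<Sum>i\<in>{..s + t} - {s}. coeff g i * coeff h (s + t - i)"
  have v_mult: "?v (a * b) = ?v a + ?v b" if "a \<noteq> 0" "b \<noteq> 0" for a b :: 'a
    using prime_elem_multiplicity_mult_distrib[OF p that] .
  have split: "coeff (g * h) (s + t) = coeff g s * coeff h t + ?rest"
    unfolding coeff_mult by (subst sum.remove[of _ s]) auto
  have "p ^ Suc e dvd coeff g i * coeff h (s + t - i)" if i: "i \<le> s + t" "i \<noteq> s" for i
  proof (cases "coeff g i = 0 \<or> coeff h (s + t - i) = 0")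
    case False
    define l where "l = s + t - i"
    have il: "i + l = s + t" using i by (simp add: l_def)
    have nz: "coeff g i \<noteq> 0" "coeff h l \<noteq> 0" using False by (auto simp: l_def)
    consider "i < s" | "l < t" using i il by linarith
    then have "?w g s + ?w h t < ?w g i + ?w h l"
      using s(2,3)[of i] t(2,3)[of l] nz by cases fastforce+
    moreover have "k * i + k * l = k * s + k * t"
      using il by (metis distrib_left)
    ultimately have "j * e < j * (?v (coeff g i) + ?v (coeff h l))"
      unfolding slope_weight_def e_def distrib_left by linarith
    then have "Suc e \<le> ?v (coeff g i * coeff h l)"
      using v_mult[OF nz] by simp
    then show ?thesis unfolding l_def by (rule multiplicity_dvd')
  qed auto
  then have rest: "p ^ Suc e dvd ?rest" by (intro dvd_sum) auto
  have lead: "?v (coeff g s * coeff h t) = e"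
    unfolding e_def using v_mult s(1) t(1) by blast
  have "p ^ e dvd coeff g s * coeff h t"
    using lead multiplicity_dvd by metis
  moreover have "p ^ e dvd ?rest" using rest power_le_dvd[of p "Suc e" _ e] by simp
  ultimately have 1: "p ^ e dvd coeff (g * h) (s + t)"
    unfolding split by (rule dvd_add)
  have "\<not> p ^ Suc e dvd coeff g s * coeff h t"
    using lead p s(1) t(1) power_dvd_iff_le_multiplicity[of "coeff g s * coeff h t" p "Suc e"]
    by (auto simp: prime_elem_def)
  then have 2: "\<not> p ^ Suc e dvd coeff (g * h) (s + t)"
    unfolding split using rest by (simp add: dvd_add_left_iff)
  have "?v (coeff (g * h) (s + t)) = e" using 1 2 by (rule multiplicity_eqI)
  then have "?w (g * h) (s + t) = ?w g s + ?w h t"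
    by (simp add: slope_weight_def e_def algebra_simps)
  moreover have "coeff (g * h) (s + t) \<noteq> 0" using 2 by auto
  ultimately show thesis using s t by (intro that[of s t]) auto
qed

text \<open>
  If \<open>p\<close> divided both constant coefficients, \<open>k\<close> and \<open>j\<close> would be positive, and \<open>(0, k)\<close> and
  \<open>(j, 0)\<close> would span an edge of the Newton polygon of \<open>g * h\<close>: its minimal weight would be
  \<open>j * k\<close>, attained at both ends. Then \<open>g\<close> would receive a part of this edge from \<open>(0, a)\<close> to
  \<open>(m, 0)\<close> with \<open>0 < a < k\<close> and, both ends having the same weight, \<open>j * a = k * m\<close>. As \<open>k\<close> is
  coprime to \<open>j\<close>, it would divide \<open>a\<close>.
\<close>
lemma coprime_edge_imp_not_both_dvd:
  fixes g h :: "'a::{factorial_semiring,idom} poly"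
  assumes p: "prime_elem p" and "coprime k j"
    and gh0: "coeff (g * h) 0 \<noteq> 0" "multiplicity p (coeff (g * h) 0) = k"
    and low: "\<And>i. i < j \<Longrightarrow> p ^ k dvd coeff (g * h) i"
    and top: "\<not> p dvd coeff (g * h) j"
  shows "\<not> (p dvd coeff g 0 \<and> p dvd coeff h 0)"
proof
  assume pdvd: "p dvd coeff g 0 \<and> p dvd coeff h 0"
  let ?w = "slope_weight p j k" and ?v = "multiplicity p"
  have nz: "coeff g 0 \<noteq> 0" "coeff h 0 \<noteq> 0" "g \<noteq> 0" "h \<noteq> 0"
    using gh0 by (auto simp: coeff_mult)
  have not_unit: "\<not> is_unit p" using p by (simp add: prime_elem_def)
  have v0: "?v (coeff g 0) + ?v (coeff h 0) = k"
    using gh0 prime_elem_multiplicity_mult_distrib[OF p nz(1,2)] by (simp add: coeff_mult)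
  have pos: "?v (coeff g 0) > 0" "?v (coeff h 0) > 0"
    using pdvd nz not_unit by (auto simp: multiplicity_gt_zero_iff)
  have j: "j > 0"
    using top pdvd by (cases "j = 0") (auto simp: coeff_mult)
  \<comment> \<open>The endpoint \<open>(j, 0)\<close> of the edge is a sum of points \<open>(m, 0)\<close> and \<open>(n, 0)\<close>.\<close>
  obtain m where m: "m \<le> j" "\<not> p dvd coeff g m * coeff h (j - m)"
    using top unfolding coeff_mult by (meson atMost_iff dvd_sum)
  define n where "n = j - m"
  have mn: "\<not> p dvd coeff g m" "\<not> p dvd coeff h n" using m(2) by (auto simp: n_def)
  obtain s t where
    min_g: "\<And>i. coeff g i \<noteq> 0 \<Longrightarrow> ?w g s \<le> ?w g i" and
    min_h: "\<And>i. coeff h i \<noteq> 0 \<Longrightarrow> ?w h t \<le> ?w h i" and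
    st: "coeff (g * h) (s + t) \<noteq> 0" "?w (g * h) (s + t) = ?w g s + ?w h t"
    by (rule least_weight_mult[OF p j nz(3,4), of k]) blast
  have "j * k \<le> ?w (g * h) (s + t)"
  proof (cases "s + t < j")
    case True
    then have "k \<le> ?v (coeff (g * h) (s + t))"
      using low st(1) not_unit by (intro multiplicity_geI) auto
    then show ?thesis by (simp add: slope_weight_def trans_le_add1)
  next
    case False
    then show ?thesis
      unfolding slope_weight_def by (metis mult.commute mult_le_mono2 not_less trans_le_add2)
  qed
  then have lower: "j * k \<le> ?w g s + ?w h t" using st(2) by simp
  have "?w g s \<le> j * ?v (coeff g 0)" "?w h t \<le> j * ?v (coeff h 0)"
    using min_g[of 0] min_h[of 0] nz by (auto simp: slope_weight_def)
  moreover have "?w g s \<le> k * m" "?w h t \<le> k * n"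
    using min_g[of m] min_h[of n] mn not_dvd_imp_multiplicity_0[OF mn(1)]
      not_dvd_imp_multiplicity_0[OF mn(2)]
    by (cases "coeff g m = 0"; cases "coeff h n = 0"; simp add: slope_weight_def)+
  moreover have "j * ?v (coeff g 0) + j * ?v (coeff h 0) = j * k"
    using v0 by (metis distrib_left)
  moreover have "k * m + k * n = j * k"
    using m(1) by (simp add: n_def flip: distrib_left)
  ultimately have "j * ?v (coeff g 0) = k * m" using lower by linarith
  then have "k dvd ?v (coeff g 0)"
    using \<open>coprime k j\<close> by (metis coprime_dvd_mult_right_iff dvd_triv_left)
  then show False using v0 pos by (auto dest: dvd_imp_le)
qed

section \<open>Constant coefficients of polynomials without small roots\<close>

text \<open>
  The modulus of the constant coefficient is that of the leading coefficient times the moduli of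
  the roots; the induction splits off one root at a time.
\<close>
lemma norm_coeff_0_gt_of_roots_gt:
  fixes q :: "complex poly"
  assumes "degree q > 0" "r \<ge> 0" "\<And>z. poly q z = 0 \<Longrightarrow> norm z > r"
  shows "norm (coeff q 0) > norm (lead_coeff q) * r ^ degree q"
  using assms
proof (induction "degree q" arbitrary: q)
  case (Suc n)
  have "\<not> constant (poly q)" using Suc.prems(1) constant_degree[of q] by simp
  then obtain z where z: "poly q z = 0" using fundamental_theorem_of_algebra by blast
  then obtain u where u: "q = [:-z, 1:] * u" by (auto simp: poly_eq_0_iff_dvd)
  have "u \<noteq> 0" using u Suc.prems(1) by auto
  then have deg: "degree q = Suc (degree u)" unfolding u by (subst degree_mult_eq) auto
  have lc: "lead_coeff q = lead_coeff u" unfolding u by (subst lead_coeff_mult) simp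
  have c0: "coeff q 0 = - z * coeff u 0" unfolding u by (simp add: coeff_mult)
  have "norm (lead_coeff u) * r ^ degree u \<le> norm (coeff u 0)"
  proof (cases "degree u = 0")
    case False
    then show ?thesis using Suc.hyps(1)[of u] Suc.hyps(2) deg Suc.prems u by fastforce
  qed simp
  moreover have "norm (coeff u 0) > 0"
  proof -
    have "poly q 0 \<noteq> 0" using Suc.prems(2) Suc.prems(3)[of 0] by auto
    then show ?thesis using c0 by (auto simp: poly_0_coeff_0)
  qed
  moreover have "norm z > r" using Suc.prems(3) z .
  ultimately have "r * (norm (lead_coeff u) * r ^ degree u) < norm z * norm (coeff u 0)"
    using Suc.prems(2) by (meson le_less_trans mult_left_mono mult_strict_right_mono)
  then show ?case unfolding lc c0 unfolding deg by (simp add: norm_mult mult_ac)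
qed simp

lemma nonconstant_int_poly_large_constant_coeff:
  fixes g :: "int poly" and d :: int
  assumes deg: "degree g > 0" and d: "d > 0"
    and roots: "\<And>z :: complex. poly (map_poly of_int g) z = 0 \<Longrightarrow> norm z > of_int d"
  shows "\<bar>coeff g 0\<bar> > d"
proof -
  let ?g = "map_poly of_int g :: complex poly"
  have deg': "degree ?g = degree g" by (simp add: degree_map_poly)
  have coeff: "coeff ?g i = of_int (coeff g i)" for i by (simp add: coeff_map_poly)
  have "\<bar>lead_coeff g\<bar> * d ^ degree g < \<bar>coeff g 0\<bar>"
  proof -
    have "norm (lead_coeff ?g) * of_int d ^ degree ?g < norm (coeff ?g 0)"
      using deg d roots by (intro norm_coeff_0_gt_of_roots_gt) (auto simp: deg')
    then have "real_of_int (\<bar>lead_coeff g\<bar> * d ^ degree g) < real_of_int \<bar>coeff g 0\<bar>"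
      by (simp add: deg' coeff)
    then show ?thesis by (simp only: of_int_less_iff)
  qed
  \<comment> \<open>Being nonzero integers, \<open>lead_coeff g\<close> and \<open>d\<close> have modulus at least \<open>1\<close>.\<close>
  moreover have "1 * d ^ 1 \<le> \<bar>lead_coeff g\<bar> * d ^ degree g"
  proof (intro mult_mono power_increasing)
    have "lead_coeff g \<noteq> 0" using deg by auto
    then show "1 \<le> \<bar>lead_coeff g\<bar>" by linarith
  qed (use deg d in auto)
  ultimately show ?thesis by simp
qed

lemma map_poly_of_int_mult:
  "(map_poly of_int (g * h) :: 'a::comm_ring_1 poly) = map_poly of_int g * map_poly of_int h"
  by (rule poly_eqI) (simp add: coeff_map_poly coeff_mult)

text \<open>
  Otherwise \<open>coeff g 0\<close> would be coprime to \<open>p ^ k\<close> and hence a divisor of \<open>d\<close>, but its modulus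
  exceeds \<open>d\<close> because the roots of \<open>g\<close> are among those of \<open>g * h\<close>.
\<close>
lemma prime_dvd_constant_coeff_of_factor:
  fixes g h :: "int poly" and p d :: int
  assumes "degree g > 0" "d > 0" "prime p"
    and roots: "\<And>z :: complex. poly (map_poly of_int (g * h)) z = 0 \<Longrightarrow> norm z > of_int d"
    and c0: "coeff g 0 dvd p ^ k * d"
  shows "p dvd coeff g 0"
proof (rule ccontr)
  assume "\<not> p dvd coeff g 0"
  then have "coprime (coeff g 0) (p ^ k)"
    using \<open>prime p\<close> by (metis coprime_commute coprime_power_right_iff prime_imp_coprime)
  then have "coeff g 0 dvd d" using c0 by (simp add: coprime_dvd_mult_right_iff)
  then have "\<bar>coeff g 0\<bar> \<le> d" using \<open>d > 0\<close> dvd_imp_le_int[of d] by simp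
  moreover have "poly (map_poly of_int (g * h)) z = 0" if "poly (map_poly of_int g) z = 0"
    for z :: complex
    using that by (simp add: map_poly_of_int_mult)
  then have "\<bar>coeff g 0\<bar> > d"
    using assms(1,2) roots by (intro nonconstant_int_poly_large_constant_coeff) auto
  ultimately show False by simp
qed

lemma int_poly_unit_of_degree_0_factor:
  fixes g f :: "int poly"
  assumes "content f = 1" "g dvd f" "degree g = 0"
  shows "is_unit g"
proof -
  obtain c where c: "g = [:c:]" using assms(3) by (elim degree_eq_zeroE)
  then have "c dvd 1" using assms(1,2) const_poly_dvd_iff_dvd_content[of c f] by simp
  then show ?thesis by (simp add: c is_unit_const_poly_iff)
qed

section \<open>The irreducibility criterion\<close>

theorem theorem1:
  fixes f :: "int poly" and p d :: int and k j :: nat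
  assumes primitive: "content f = 1"
    and zeros: "\<And>\<theta> :: complex. poly (map_poly of_int f) \<theta> = 0 \<Longrightarrow> cmod \<theta> > of_int d"
    and k_pos: "k > 0" and d_pos: "d > 0"
    and p_prime: "prime p" and p_d: "\<not> p dvd d"
    and a0: "coeff f 0 = p ^ k * d \<or> coeff f 0 = - (p ^ k * d)"
    and j_range: "j \<in> {1..degree f}"
    and coprime_kj: "gcd k j = 1"
    and dvd_gcd: "p ^ k dvd (GCD i\<in>{0..<j}. coeff f i)"
    and aj: "k > 1 \<Longrightarrow> \<not> p dvd coeff f j"
  shows "irreducible f"
proof (rule irreducibleI)
  show "f \<noteq> 0" "\<not> is_unit f" using j_range by (auto simp: is_unit_poly_iff)
next
  fix g h assume f: "f = g * h"
  show "is_unit g \<or> is_unit h"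
  proof (rule ccontr)
    assume "\<not> (is_unit g \<or> is_unit h)"
    then have deg: "degree g > 0" "degree h > 0"
      using int_poly_unit_of_degree_0_factor[OF primitive, of g]
        int_poly_unit_of_degree_0_factor[OF primitive, of h] f by auto
    have prod: "coeff f 0 = coeff g 0 * coeff h 0" by (simp add: f coeff_mult)
    have p: "prime_elem p" using p_prime by (rule prime_imp_prime_elem)
    have assoc: "coeff f 0 dvd p ^ k * d" using a0 by auto
    have pg: "p dvd coeff g 0"
      using deg d_pos p_prime zeros assoc unfolding f prod[unfolded f]
      by (intro prime_dvd_constant_coeff_of_factor[of g d p h k]) (auto intro: dvd_mult_left)
    have ph: "p dvd coeff h 0"
      using deg d_pos p_prime zeros assoc unfolding f prod[unfolded f]
      by (intro prime_dvd_constant_coeff_of_factor[of h d p g k])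
        (auto simp: mult.commute intro: dvd_mult_right)
    have nz: "coeff f 0 \<noteq> 0" using a0 d_pos p_prime by auto
    have "p \<noteq> 0" using p_prime by auto
    then have "multiplicity p (p ^ k * d) = k"
      using d_pos multiplicity_prime_power[OF p, of k] not_dvd_imp_multiplicity_0[OF p_d]
        prime_elem_multiplicity_mult_distrib[OF p, of "p ^ k" d]
      by simp
    then have v0: "multiplicity p (coeff f 0) = k"
      using a0 multiplicity_times_unit_right[of "-1" p "p ^ k * d"] by auto
    show False
    proof (cases "k = 1")
      case True
      have "p ^ 2 dvd coeff f 0"
        unfolding prod power2_eq_square using pg ph by (rule mult_dvd_mono)
      then show False
        using v0 True nz p power_dvd_iff_le_multiplicity[of "coeff f 0" p 2]
        by (auto simp: prime_elem_def)
    next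
      case False
      have "p ^ k dvd coeff f i" if "i < j" for i
        using dvd_gcd that by (meson Gcd_dvd atLeastLessThan_iff dvd_trans image_eqI zero_le)
      moreover have "\<not> p dvd coeff f j" using aj False k_pos by simp
      moreover have "coprime k j" using coprime_kj by (simp add: coprime_iff_gcd_eq_1)
      ultimately have "\<not> (p dvd coeff g 0 \<and> p dvd coeff h 0)"
        using p nz v0 unfolding f by (intro coprime_edge_imp_not_both_dvd)
      with pg ph show False by blast
    qed
  qed
qed

end
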